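(* Let $n>0$ be a natural number and let $$A_n(t_1,t_2,\mu_1,\mu_2)=\sum_{k=1}^{n}\delta\left(\frac{t_1^{n-k+1}}{t_2^{k-1}},\,\mu_1^{k}\mu_2^{n-k}\right)\,\delta\left(\frac{t_2^{k}}{t_1^{n-k}},\,\mu_1^{k-1}\mu_2^{n-k+1}\right),$$ a meromorphic function of $t_1,t_2,\mu_1,\mu_2\in\mathbb{C}^*$. Then $A_n$ is antisymmetric with respect to the change of variables $t_1\leftrightarrow\mu_1$, $t_2\leftrightarrow\mu_2^{-1}$, that is, $$A_n(\mu_1,\mu_2^{-1},t_1,t_2^{-1})=-A_n(t_1,t_2,\mu_1,\mu_2).$$
   Context: Notation: $\mathrm{e}(x)=e^{2\pi i x}$. Let $\tau\in\mathbb{C}$ with $\operatorname{im}(\tau)>0$ and $q=\mathrm{e}(\tau)=e^{2\pi i\tau}$. The Jacobi theta function is $$\theta_\tau(\upsilon)=2q^{1/8}\sin(\pi\upsilon)\prod_{l=1}^\infty(1-q^l)\big(1-q^l\mathrm{e}(\upsilon)\big)\big(1-q^l/\mathrm{e}(\upsilon)\big),\qquad q^{1/8}:=e^{\pi i\tau/4}.$$ Put $$\Delta_\tau(a,b)=\frac{\theta_\tau'(0)\,\theta_\tau(a+b)}{\theta_\tau(a)\,\theta_\tau(b)},$$ where $\theta_\tau'$ is the derivative in $\upsilon$. Since $\Delta_\tau(a+1,b)=\Delta_\tau(a,b)=\Delta_\tau(a,b+1)$, there is a well-defined meromorphic function $\delta$ on $\mathbb{C}^*\times\mathbb{C}^*$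 (depending on $\tau$) given by $$\delta(\mathrm{e}(a),\mathrm{e}(b))=\frac1{2\pi i}\Delta_\tau(a,b).$$ Equivalently, $\delta(A,B)=\dfrac{\vartheta'(1)\,\vartheta(AB)}{\vartheta(A)\,\vartheta(B)}$ with $\vartheta(x)=x^{1/2}(1-x^{-1})\prod_{\ell=1}^\infty(1-q^\ell x)(1-q^\ell/x)$, where the half-integer powers cancel in the quotient. *)

theory Defs
  imports "HOL-Analysis.Analysis"
begin

definition e2pi :: "complex \<Rightarrow> complex" where
  "e2pi x = exp (2 * of_real pi * \<i> * x)"

text \<open>The product over \<open>l \<ge> 1\<close> is written with index shifted by one, since
  \<^const>\<open>prodinf\<close> starts at \<open>0\<close>.\<close>

definition theta :: "complex \<Rightarrow> complex \<Rightarrow> complex" where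
  "theta \<tau> v = (let q = e2pi \<tau> in
     2 * exp (of_real pi * \<i> * \<tau> / 4) * sin (of_real pi * v) *
     (\<Prod>l. (1 - q ^ Suc l) * (1 - q ^ Suc l * e2pi v) * (1 - q ^ Suc l / e2pi v)))"

definition Delta :: "complex \<Rightarrow> complex \<Rightarrow> complex \<Rightarrow> complex" where
  "Delta \<tau> a b = deriv (theta \<tau>) 0 * theta \<tau> (a + b) / (theta \<tau> a * theta \<tau> b)"

text \<open>The value of \<open>\<delta>\<close> at \<open>(A, B)\<close> is the common value of \<open>\<Delta>\<^sub>\<tau>(a, b) / (2 \<pi> i)\<close>
  over all logarithms \<open>a\<close>, \<open>b\<close> of \<open>A\<close>, \<open>B\<close>; \<open>delta_e2pi\<close> below shows that it exists.\<close>

definition delta :: "complex \<Rightarrow> complex \<Rightarrow> complex \<Rightarrow> complex" where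
  "delta \<tau> A B = (THE d. \<forall>a b. e2pi a = A \<longrightarrow> e2pi b = B \<longrightarrow>
                        d = 1 / (2 * of_real pi * \<i>) * Delta \<tau> a b)"

text \<open>The zeros of \<open>\<theta>\<^sub>\<tau>\<close> are the points of \<open>\<int> + \<tau>\<int>\<close>, so the polar locus of \<open>\<delta>\<close> consists of
  the \<open>(A, B)\<close> for which \<open>A\<close> or \<open>B\<close> is an integral power of \<open>q\<close>.\<close>

definition delta_dom :: "complex \<Rightarrow> (complex \<times> complex) set" where
  "delta_dom \<tau> = {(A, B). A \<noteq> 0 \<and> B \<noteq> 0 \<and> (\<forall>m::int. A \<noteq> e2pi \<tau> powi m \<and> B \<noteq> e2pi \<tau> powi m)}"

definition A_fun :: "complex \<Rightarrow> nat \<Rightarrow> complex \<Rightarrow> complex \<Rightarrow> complex \<Rightarrow> complex \<Rightarrow> complex" where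
  "A_fun \<tau> n t1 t2 \<mu>1 \<mu>2 =
     (\<Sum>k = 1..n. delta \<tau> (t1 ^ (n - k + 1) / t2 ^ (k - 1)) (\<mu>1 ^ k * \<mu>2 ^ (n - k)) *
                 delta \<tau> (t2 ^ k / t1 ^ (n - k)) (\<mu>1 ^ (k - 1) * \<mu>2 ^ (n - k + 1)))"

text \<open>The points of \<open>(\<complex>\<^sup>*)\<^sup>4\<close> at which no summand of \<open>A\<^sub>n\<close> has a pole in either factor. This is the
  complement of countably many hypersurfaces (monomial = power of \<open>q\<close>), so an identity between
  meromorphic functions is the same as an identity of values on this set.\<close>

definition A_dom :: "complex \<Rightarrow> nat \<Rightarrow> (complex \<times> complex \<times> complex \<times> complex) set" where
  "A_dom \<tau> n = {(t1, t2, \<mu>1, \<mu>2). t1 \<noteq> 0 \<and> t2 \<noteq> 0 \<and> \<mu>1 \<noteq> 0 \<and> \<mu>2 \<noteq> 0 \<and>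
     (\<forall>k \<in> {1..n}.
        (t1 ^ (n - k + 1) / t2 ^ (k - 1), \<mu>1 ^ k * \<mu>2 ^ (n - k)) \<in> delta_dom \<tau> \<and>
        (t2 ^ k / t1 ^ (n - k), \<mu>1 ^ (k - 1) * \<mu>2 ^ (n - k + 1)) \<in> delta_dom \<tau>)}"

lemma e2pi_eq_iff: "e2pi a = e2pi b \<longleftrightarrow> (\<exists>m::int. a = b + of_int m)"
proof -
  have "2 * of_real pi * \<i> * a = 2 * of_real pi * \<i> * b + of_real (2 * of_int m * pi) * \<i>
        \<longleftrightarrow> a = b + of_int m" for m :: int
  proof -
    have "2 * of_real pi * \<i> * b + of_real (2 * of_int m * pi) * \<i>
          = (2 * of_real pi * \<i>) * (b + of_int m)"
      by (simp add: algebra_simps)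
    then show ?thesis by simp
  qed
  then show ?thesis
    unfolding e2pi_def exp_eq by simp
qed

lemma theta_plus_1: "theta \<tau> (v + 1) = - theta \<tau> v"
proof -
  have "e2pi (v + 1) = e2pi v"
    unfolding e2pi_eq_iff by (rule exI[of _ 1]) simp
  moreover have "sin (of_real pi * (v + 1)) = - sin (of_real pi * v :: complex)"
    by (simp add: distrib_left sin_add flip: sin_of_real cos_of_real)
  ultimately show ?thesis
    by (simp add: theta_def Let_def)
qed

lemma Delta_commute: "Delta \<tau> a b = Delta \<tau> b a"
  by (simp add: Delta_def add.commute mult.commute)

lemma Delta_plus_1: "Delta \<tau> (a + 1) b = Delta \<tau> a b"
proof -
  have "theta \<tau> (a + 1 + b) = - theta \<tau> (a + b)"
    using theta_plus_1[of \<tau> "a + b"] by (simp add: ac_simps)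
  then show ?thesis by (simp add: Delta_def theta_plus_1)
qed

lemma Delta_plus_of_int: "Delta \<tau> (a + of_int m) b = Delta \<tau> a b"
proof (induction m arbitrary: a rule: int_induct[of _ 0])
  case base
  show ?case by simp
next
  case (step1 i)
  then show ?case
    using Delta_plus_1[of \<tau> "a + of_int i" b] by (simp add: ac_simps)
next
  case (step2 i)
  then show ?case
    using Delta_plus_1[of \<tau> "a + of_int (i - 1)" b] by (simp add: algebra_simps)
qed

lemma delta_e2pi: "delta \<tau> (e2pi a) (e2pi b) = 1 / (2 * of_real pi * \<i>) * Delta \<tau> a b"
proof -
  have *: "Delta \<tau> a' b' = Delta \<tau> a b" if ab: "e2pi a' = e2pi a" "e2pi b' = e2pi b" for a' b'
  proof -
    obtain k m :: int where "a' = a + of_int k" "b' = b + of_int m"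
      using ab unfolding e2pi_eq_iff by blast
    then have "Delta \<tau> a' b' = Delta \<tau> a (b + of_int m)"
      by (simp only: Delta_plus_of_int)
    also have "\<dots> = Delta \<tau> (b + of_int m) a" by (rule Delta_commute)
    also have "\<dots> = Delta \<tau> b a" by (rule Delta_plus_of_int)
    also have "\<dots> = Delta \<tau> a b" by (rule Delta_commute)
    finally show ?thesis .
  qed
  show ?thesis
    unfolding delta_def
  proof (rule the_equality, intro allI impI)
    fix a' b' assume "e2pi a' = e2pi a" "e2pi b' = e2pi b"
    then have "Delta \<tau> a' b' = Delta \<tau> a b" by (rule *)
    then show "1 / (2 * of_real pi * \<i>) * Delta \<tau> a b = 1 / (2 * of_real pi * \<i>) * Delta \<tau> a' b'"
      by (rule arg_cong[OF sym])
  next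
    fix d
    assume "\<forall>a' b'. e2pi a' = e2pi a \<longrightarrow> e2pi b' = e2pi b \<longrightarrow>
              d = 1 / (2 * of_real pi * \<i>) * Delta \<tau> a' b'"
    then show "d = 1 / (2 * of_real pi * \<i>) * Delta \<tau> a b" by blast
  qed
qed

lemma delta_dom_swap: "(A, B) \<in> delta_dom \<tau> \<Longrightarrow> (B, A) \<in> delta_dom \<tau>"
  by (simp add: delta_dom_def)

lemma delta_dom_inverse:
  assumes "(A, B) \<in> delta_dom \<tau>"
  shows "(inverse A, inverse B) \<in> delta_dom \<tau>"
proof -
  have "inverse x \<noteq> e2pi \<tau> powi m" if "\<forall>m::int. x \<noteq> e2pi \<tau> powi m" for x m
    using that[rule_format, of "- m"] by (metis inverse_inverse_eq power_int_minus)
  then show ?thesis using assms by (simp add: delta_dom_def)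
qed

text \<open>The change of variables preserves the set of regular points.\<close>

lemma A_dom_swap:
  assumes "(t1, t2, \<mu>1, \<mu>2) \<in> A_dom \<tau> n"
  shows "(\<mu>1, inverse \<mu>2, t1, inverse t2) \<in> A_dom \<tau> n"
proof -
  have "(\<mu>1 ^ (n - k + 1) / inverse \<mu>2 ^ (k - 1), t1 ^ k * inverse t2 ^ (n - k)) \<in> delta_dom \<tau> \<and>
        (inverse \<mu>2 ^ k / \<mu>1 ^ (n - k), t1 ^ (k - 1) * inverse t2 ^ (n - k + 1)) \<in> delta_dom \<tau>"
    if k: "k \<in> {1..n}" for k
  proof -
    define j where "j = n - k + 1"
    have j: "j \<in> {1..n}" and eqs: "n - k + 1 = j" "k - 1 = n - j" "k = n - j + 1" "n - k = j - 1"
      using k by (auto simp: j_def)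
    have 1: "(t1 ^ (n - j + 1) / t2 ^ (j - 1), \<mu>1 ^ j * \<mu>2 ^ (n - j)) \<in> delta_dom \<tau>"
      and 2: "(t2 ^ j / t1 ^ (n - j), \<mu>1 ^ (j - 1) * \<mu>2 ^ (n - j + 1)) \<in> delta_dom \<tau>"
      using assms j by (auto simp: A_dom_def)
    have "(\<mu>1 ^ j / inverse \<mu>2 ^ (n - j), t1 ^ (n - j + 1) * inverse t2 ^ (j - 1)) \<in> delta_dom \<tau>"
      using delta_dom_swap[OF 1] by (simp add: divide_inverse power_inverse)
    moreover have "(inverse \<mu>2 ^ (n - j + 1) / \<mu>1 ^ (j - 1), t1 ^ (n - j) * inverse t2 ^ j) \<in> delta_dom \<tau>"
      using delta_dom_inverse[OF delta_dom_swap[OF 2]]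
      by (simp add: divide_inverse power_inverse mult_ac)
    ultimately show ?thesis
      using eqs by metis
  qed
  then show ?thesis using assms by (simp add: A_dom_def)
qed

end

theory Submission
  imports Defs
begin

text \<open>
  The identity holds summand by summand, once one of the two sums is read backwards. Write the
  \<open>j\<close>-th summand of \<open>A\<^sub>n(t\<^sub>1, t\<^sub>2, \<mu>\<^sub>1, \<mu>\<^sub>2)\<close> as \<open>\<delta>(A\<^sub>j, B\<^sub>j) \<delta>(C\<^sub>j, D\<^sub>j)\<close>. The substitution
  \<open>t\<^sub>1 \<leftrightarrow> \<mu>\<^sub>1\<close>, \<open>t\<^sub>2 \<leftrightarrow> \<mu>\<^sub>2\<^sup>-\<^sup>1\<close> turns the summand with index \<open>n + 1 - j\<close> into
  \<open>\<delta>(B\<^sub>j, A\<^sub>j) \<delta>(D\<^sub>j\<^sup>-\<^sup>1, C\<^sub>j\<^sup>-\<^sup>1)\<close>. Now \<open>\<delta>\<close> is symmetric (lemma \<open>delta_commute\<close>) and changes sign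
  when both arguments are inverted (lemma \<open>delta_inverse\<close>); the latter reflects the fact that
  \<open>\<theta>\<^sub>\<tau>\<close> is odd, so that \<open>\<theta>(a + b) / (\<theta>(a) \<theta>(b))\<close> involves an odd number of odd factors.
\<close>

lemma e2pi_minus: "e2pi (- v) = inverse (e2pi v)"
  by (simp add: e2pi_def exp_minus)

lemma e2pi_surj:
  assumes "A \<noteq> 0"
  shows "\<exists>a. A = e2pi a"
proof -
  obtain w where "A = exp w"
    using assms by (metis exp_Ln)
  then have "A = e2pi (w / (2 * of_real pi * \<i>))"
    by (simp add: e2pi_def)
  then show ?thesis by (rule exI)
qed

text \<open>The sine is odd, and \<open>v \<mapsto> - v\<close> merely exchanges the last two factors in each term of the
  infinite product.\<close>

lemma theta_minus: "theta \<tau> (- v) = - theta \<tau> v"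
proof -
  have "(1 - c) * (1 - c * e2pi (- v)) * (1 - c / e2pi (- v)) =
        (1 - c) * (1 - c * e2pi v) * (1 - c / e2pi v)" for c
    unfolding e2pi_minus divide_inverse inverse_inverse_eq
    by (simp only: mult.assoc mult.commute[of "1 - c * inverse (e2pi v)"])
  moreover have "sin (of_real pi * - v) = - sin (of_real pi * v)"
    by simp
  ultimately show ?thesis
    unfolding theta_def Let_def by (simp only: mult_minus_left mult_minus_right)
qed

lemma Delta_minus: "Delta \<tau> (- a) (- b) = - Delta \<tau> a b"
proof -
  have "theta \<tau> (- a + - b) = - theta \<tau> (a + b)"
    using theta_minus[of \<tau> "a + b"] by (simp only: minus_add_distrib)
  then show ?thesis
    unfolding Delta_def theta_minus by simp
qed

lemma delta_commute:
  assumes "A \<noteq> 0" "B \<noteq> 0"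
  shows "delta \<tau> A B = delta \<tau> B A"
proof -
  obtain a b where "A = e2pi a" "B = e2pi b"
    using e2pi_surj[OF assms(1)] e2pi_surj[OF assms(2)] by blast
  then show ?thesis by (simp add: delta_e2pi Delta_commute[of \<tau> a b])
qed

lemma delta_inverse:
  assumes "A \<noteq> 0" "B \<noteq> 0"
  shows "delta \<tau> (inverse A) (inverse B) = - delta \<tau> A B"
proof -
  obtain a b where "A = e2pi a" "B = e2pi b"
    using e2pi_surj[OF assms(1)] e2pi_surj[OF assms(2)] by blast
  then show ?thesis
    by (simp add: e2pi_minus[symmetric] delta_e2pi Delta_minus)
qed

theorem proposition10p1:
  fixes \<tau> t1 t2 \<mu>1 \<mu>2 :: complex and n :: nat
  assumes "Im \<tau> > 0" and "n > 0"
    and "(t1, t2, \<mu>1, \<mu>2) \<in> A_dom \<tau> n"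
  shows "A_fun \<tau> n \<mu>1 (inverse \<mu>2) t1 (inverse t2) = - A_fun \<tau> n t1 t2 \<mu>1 \<mu>2"
proof -
  have nz: "t1 \<noteq> 0" "t2 \<noteq> 0" "\<mu>1 \<noteq> 0" "\<mu>2 \<noteq> 0"
    using assms(3) by (auto simp: A_dom_def)
  define f where "f k = delta \<tau> (t1 ^ (n - k + 1) / t2 ^ (k - 1)) (\<mu>1 ^ k * \<mu>2 ^ (n - k)) *
                        delta \<tau> (t2 ^ k / t1 ^ (n - k)) (\<mu>1 ^ (k - 1) * \<mu>2 ^ (n - k + 1))" for k
  define g where "g k = delta \<tau> (\<mu>1 ^ (n - k + 1) / inverse \<mu>2 ^ (k - 1))
                                (t1 ^ k * inverse t2 ^ (n - k)) *
                        delta \<tau> (inverse \<mu>2 ^ k / \<mu>1 ^ (n - k))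
                                (t1 ^ (k - 1) * inverse t2 ^ (n - k + 1))" for k
  have g_eq: "g (n + 1 - j) = - f j" if j: "j \<in> {1..n}" for j
  proof -
    define A B C D where "A = t1 ^ (n - j + 1) / t2 ^ (j - 1)" and "B = \<mu>1 ^ j * \<mu>2 ^ (n - j)"
      and "C = t2 ^ j / t1 ^ (n - j)" and "D = \<mu>1 ^ (j - 1) * \<mu>2 ^ (n - j + 1)"
    have ABCD_nz: "A \<noteq> 0" "B \<noteq> 0" "C \<noteq> 0" "D \<noteq> 0"
      using nz by (auto simp: A_def B_def C_def D_def)
    have idx: "j - 1 + 1 = j" "n + 1 - j - 1 = n - j" "n + 1 - j = n - j + 1"
      "n - (n + 1 - j) = j - 1"
      using j by auto
    have B: "\<mu>1 ^ j / inverse \<mu>2 ^ (n - j) = B"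
      by (simp add: B_def divide_inverse power_inverse)
    have A: "t1 ^ (n - j + 1) * inverse t2 ^ (j - 1) = A"
      by (simp add: A_def divide_inverse power_inverse)
    have D: "inverse \<mu>2 ^ (n - j + 1) / \<mu>1 ^ (j - 1) = inverse D"
      unfolding D_def divide_inverse power_inverse inverse_mult_distrib by (rule mult.commute)
    have C: "t1 ^ (n - j) * inverse t2 ^ j = inverse C"
      unfolding C_def divide_inverse power_inverse inverse_mult_distrib inverse_inverse_eq
      by (rule mult.commute)
    have "g (n + 1 - j) = delta \<tau> B A * delta \<tau> (inverse D) (inverse C)"
      unfolding g_def idx(2) idx(4) A[symmetric] B[symmetric] C[symmetric] D[symmetric]
      by (simp only: idx)
    also have "\<dots> = - (delta \<tau> A B * delta \<tau> C D)"
      using ABCD_nz by (simp add: delta_inverse delta_commute[of B A] delta_commute[of D C])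
    also have "\<dots> = - f j"
      by (simp add: f_def A_def B_def C_def D_def)
    finally show ?thesis .
  qed
  have "A_fun \<tau> n \<mu>1 (inverse \<mu>2) t1 (inverse t2) = (\<Sum>k = 1..n. g k)"
    by (simp add: A_fun_def g_def)
  also have "\<dots> = (\<Sum>j = 1..n. g (n + 1 - j))"
    using sum.atLeastAtMost_rev[of g 1 n] by simp
  also have "\<dots> = - (\<Sum>j = 1..n. f j)"
    by (simp only: g_eq sum_negf cong: sum.cong)
  also have "\<dots> = - A_fun \<tau> n t1 t2 \<mu>1 \<mu>2"
    by (simp add: A_fun_def f_def)
  finally show ?thesis .
qed

end
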